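(* For a graph $G$ and an integer $r\geq 1$, $\mathrm{tw}_r(G)\leq \mathrm{sn}_r(G)\leq \mathrm{gon}_r(G)$.
   Context: A graph is a finite, connected, undirected multigraph without loops. A vertex set $A$ is $r$-edge-connected if $G[A]$ remains connected after deleting any $r-1$ edges (a single vertex counts). A multiset $C$ of vertices $r$-intersects a set $A$ if at least $r$ elements of $C$, counted with multiplicity, lie in $A$; for a collection $\mathcal{F}$ of vertex sets, $h_r(\mathcal F)$ is the minimum size of a multiset $r$-intersecting every member. An $r$-bramble is a collection $\mathcal B$ of $r$-edge-connected vertex subsets such that any two $B,B'\in\mathcal B$ either intersect or have at least $r$ edges between them; its order is $h_r(\mathcal B)$, $\mathrm{bn}_r(G)$ is the maximum order of an $r$-bramble, and $\mathrm{tw}_r(G)=\mathrm{bn}_r(G)-r$. An $r$-scramble is a collection of nonempty $r$-edge-connected vertex subsets (eggs); $e(\mathcal S)$ is the minimum number of edges whose deletion disconnects $G$ into components at least two of which contain an egg; its order is $\min\{h_r(\mathcal S),e(\mathcal S)\}$, and $\mathrm{sn}_r(G)$ is the maximum order of an $r$-scramble. A divisor is $D=\sum_v D(v)(v)$, $\deg D=\sum D(v)$, effective if all $D(v)\ge0$; firing $v$ gives $D'(v)=D(v)-\mathrm{val}(v)$, $D'(w)=D(w)+(\#\text{edges }vw)$; linear equivalence is generated by firings; $r(D)=-1$ if $D$ is not equivalent to an effective divisor, else the largest $r\ge0$ with $D-E$ equivalent to an effective divisor for every effective $E$ of degree $r$. $\mathrm{gon}_r(G)$ is the minimum degree of a divisor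 of rank at least $r$. *)

theory Defs
  imports Main "HOL-Library.Multiset" "HOL-Library.Extended_Nat"
begin

section \<open>Multigraphs\<close>

record ('v, 'e) mgraph =
  verts :: "'v set"
  edges :: "'e set"
  ends :: "'e \<Rightarrow> 'v set"

definition adj_rel :: "('v, 'e) mgraph \<Rightarrow> ('v \<times> 'v) set" where
  "adj_rel G = {(u, w). \<exists>e\<in>edges G. ends G e = {u, w}}"

text \<open>The graph without vertices is not connected.\<close>

definition mg_connected :: "('v, 'e) mgraph \<Rightarrow> bool" where
  "mg_connected G \<longleftrightarrow>
     verts G \<noteq> {} \<and> (\<forall>u\<in>verts G. \<forall>w\<in>verts G. (u, w) \<in> (adj_rel G)\<^sup>*)"

text \<open>Parallel edges are distinct elements of the edge set with the same ends;
  requiring two distinct ends excludes loops.\<close>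

definition multigraph :: "('v, 'e) mgraph \<Rightarrow> bool" where
  "multigraph G \<longleftrightarrow>
     finite (verts G) \<and> finite (edges G) \<and>
     (\<forall>e\<in>edges G. ends G e \<subseteq> verts G \<and> card (ends G e) = 2) \<and>
     mg_connected G"

definition delete_edges :: "('v, 'e) mgraph \<Rightarrow> 'e set \<Rightarrow> ('v, 'e) mgraph" where
  "delete_edges G F = G\<lparr>edges := edges G - F\<rparr>"

definition induced :: "('v, 'e) mgraph \<Rightarrow> 'v set \<Rightarrow> ('v, 'e) mgraph" where
  "induced G A = G\<lparr>verts := A, edges := {e \<in> edges G. ends G e \<subseteq> A}\<rparr>"

definition mg_components :: "('v, 'e) mgraph \<Rightarrow> 'v set set" where
  "mg_components G = {{w \<in> verts G. (v, w) \<in> (adj_rel G)\<^sup>*} | v. v \<in> verts G}"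

definition edges_between :: "('v, 'e) mgraph \<Rightarrow> 'v set \<Rightarrow> 'v set \<Rightarrow> 'e set" where
  "edges_between G A B = {e \<in> edges G. \<exists>u\<in>A. \<exists>w\<in>B. ends G e = {u, w}}"

text \<open>``Any \<open>r - 1\<close> edges'' means at most \<open>r - 1\<close> edges, so that an induced subgraph with
  fewer than \<open>r - 1\<close> edges does not qualify vacuously. The empty set never qualifies
  and a singleton always does.\<close>

definition edge_connected :: "('v, 'e) mgraph \<Rightarrow> nat \<Rightarrow> 'v set \<Rightarrow> bool" where
  "edge_connected G r A \<longleftrightarrow>
     (\<forall>F. F \<subseteq> edges (induced G A) \<and> card F \<le> r - 1 \<longrightarrow>
        mg_connected (delete_edges (induced G A) F))"

section \<open>Brambles and scrambles\<close>

definition r_intersects :: "nat \<Rightarrow> 'v multiset \<Rightarrow> 'v set \<Rightarrow> bool" where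
  "r_intersects r C A \<longleftrightarrow> r \<le> size (filter_mset (\<lambda>v. v \<in> A) C)"

definition hitting_number :: "('v, 'e) mgraph \<Rightarrow> nat \<Rightarrow> 'v set set \<Rightarrow> nat" where
  "hitting_number G r \<F> =
     (LEAST n. \<exists>C. set_mset C \<subseteq> verts G \<and> size C = n \<and> (\<forall>A\<in>\<F>. r_intersects r C A))"

definition is_bramble :: "('v, 'e) mgraph \<Rightarrow> nat \<Rightarrow> 'v set set \<Rightarrow> bool" where
  "is_bramble G r \<B> \<longleftrightarrow>
     (\<forall>B\<in>\<B>. B \<subseteq> verts G \<and> edge_connected G r B) \<and>
     (\<forall>B\<in>\<B>. \<forall>B'\<in>\<B>. B \<inter> B' \<noteq> {} \<or> r \<le> card (edges_between G B B'))"

definition bramble_number :: "('v, 'e) mgraph \<Rightarrow> nat \<Rightarrow> nat" where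
  "bramble_number G r = Max {hitting_number G r \<B> | \<B>. is_bramble G r \<B>}"

definition treewidth :: "('v, 'e) mgraph \<Rightarrow> nat \<Rightarrow> int" where
  "treewidth G r = int (bramble_number G r) - int r"

definition is_scramble :: "('v, 'e) mgraph \<Rightarrow> nat \<Rightarrow> 'v set set \<Rightarrow> bool" where
  "is_scramble G r \<S> \<longleftrightarrow> (\<forall>A\<in>\<S>. A \<noteq> {} \<and> A \<subseteq> verts G \<and> edge_connected G r A)"

definition is_egg_cut :: "('v, 'e) mgraph \<Rightarrow> 'v set set \<Rightarrow> 'e set \<Rightarrow> bool" where
  "is_egg_cut G \<S> F \<longleftrightarrow>
     F \<subseteq> edges G \<and>
     (\<exists>X\<in>mg_components (delete_edges G F). \<exists>Y\<in>mg_components (delete_edges G F).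
        X \<noteq> Y \<and> (\<exists>A\<in>\<S>. A \<subseteq> X) \<and> (\<exists>B\<in>\<S>. B \<subseteq> Y))"

text \<open>The value is \<open>\<infinity>\<close> if there is no egg-cut, for instance if any two eggs intersect;
  the order of the scramble is then its hitting number.\<close>

definition egg_cut_number :: "('v, 'e) mgraph \<Rightarrow> 'v set set \<Rightarrow> enat" where
  "egg_cut_number G \<S> = (INF F\<in>{F. is_egg_cut G \<S> F}. enat (card F))"

definition scramble_order :: "('v, 'e) mgraph \<Rightarrow> nat \<Rightarrow> 'v set set \<Rightarrow> nat" where
  "scramble_order G r \<S> = the_enat (min (enat (hitting_number G r \<S>)) (egg_cut_number G \<S>))"

definition scramble_number :: "('v, 'e) mgraph \<Rightarrow> nat \<Rightarrow> nat" where
  "scramble_number G r = Max {scramble_order G r \<S> | \<S>. is_scramble G r \<S>}"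

section \<open>Divisors and gonality\<close>

text \<open>Divisors are integer-valued functions on all of \<^typ>\<open>'v\<close> that vanish outside the
  vertex set.\<close>

definition is_divisor :: "('v, 'e) mgraph \<Rightarrow> ('v \<Rightarrow> int) \<Rightarrow> bool" where
  "is_divisor G D \<longleftrightarrow> (\<forall>v. v \<notin> verts G \<longrightarrow> D v = 0)"

definition deg :: "('v, 'e) mgraph \<Rightarrow> ('v \<Rightarrow> int) \<Rightarrow> int" where
  "deg G D = (\<Sum>v\<in>verts G. D v)"

definition is_effective :: "('v, 'e) mgraph \<Rightarrow> ('v \<Rightarrow> int) \<Rightarrow> bool" where
  "is_effective G D \<longleftrightarrow> is_divisor G D \<and> (\<forall>v\<in>verts G. 0 \<le> D v)"

definition val :: "('v, 'e) mgraph \<Rightarrow> 'v \<Rightarrow> nat" where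
  "val G v = card {e \<in> edges G. v \<in> ends G e}"

definition fire :: "('v, 'e) mgraph \<Rightarrow> 'v \<Rightarrow> ('v \<Rightarrow> int) \<Rightarrow> ('v \<Rightarrow> int)" where
  "fire G v D = (\<lambda>w. if w = v then D v - int (val G v)
                     else D w + int (card {e \<in> edges G. ends G e = {v, w}}))"

definition lin_equiv :: "('v, 'e) mgraph \<Rightarrow> ('v \<Rightarrow> int) \<Rightarrow> ('v \<Rightarrow> int) \<Rightarrow> bool" where
  "lin_equiv G = equivclp (\<lambda>D D'. \<exists>v\<in>verts G. D' = fire G v D)"

definition equiv_effective :: "('v, 'e) mgraph \<Rightarrow> ('v \<Rightarrow> int) \<Rightarrow> bool" where
  "equiv_effective G D \<longleftrightarrow> (\<exists>D'. is_effective G D' \<and> lin_equiv G D D')"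

definition rank :: "('v, 'e) mgraph \<Rightarrow> ('v \<Rightarrow> int) \<Rightarrow> int" where
  "rank G D =
     (if \<not> equiv_effective G D then - 1
      else int (GREATEST k. \<forall>E. is_effective G E \<and> deg G E = int k \<longrightarrow>
                              equiv_effective G (\<lambda>v. D v - E v)))"

definition gonality :: "('v, 'e) mgraph \<Rightarrow> nat \<Rightarrow> int" where
  "gonality G r = (LEAST d. \<exists>D. is_divisor G D \<and> int r \<le> rank G D \<and> deg G D = d)"

end

theory Submission
  imports Defs
begin

text \<open>For \<open>tw\<^sub>r \<le> sn\<^sub>r\<close>, every bramble \<open>\<B>\<close> satisfies \<open>h\<^sub>r(\<B>) \<le> e(\<B>) + r\<close>. Given an egg-cut
  \<open>\<delta>(U)\<close>, take one end of every cut edge: a member of \<open>\<B>\<close> crossing the cut contains \<open>r\<close> cut edges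
  and is hit. Choose the end outside \<open>U\<close> for as many edges as possible while still hitting
  all members inside \<open>U\<close>. By maximality, some member \<open>A\<close> inside \<open>U\<close> is hit at most \<open>r\<close> times; adding
  the outer ends of the at most \<open>r\<close> edges responsible hits all members outside \<open>U\<close>, because each of
  them is joined to \<open>A\<close> by \<open>r\<close> cut edges.

  For \<open>sn\<^sub>r \<le> gon\<^sub>r\<close>, let \<open>D\<close> be an effective divisor of rank at least \<open>r\<close> that \<open>r\<close>-intersects the largest
  number of eggs in its class, and suppose it misses an egg \<open>A\<close>. Move \<open>D\<close> to an equivalent effective
  divisor with \<open>r\<close> chips on a vertex of \<open>A\<close> by firing an increasing chain \<open>U\<^sub>0 \<subseteq> U\<^sub>1 \<subseteq> \<dots>\<close> of sets through
  effective divisors. An egg can start being hit only if it is disjoint from the fired set and stop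
  being hit only if it is contained in it, since a crossing egg has \<open>r\<close> edges across. By maximality,
  some egg \<open>B\<close> is lost no later than \<open>A\<close> is gained, so the set fired when \<open>A\<close> is gained separates \<open>B\<close>
  from \<open>A\<close>, and each edge of this egg-cut carries a chip of \<open>D\<close>.\<close>

section \<open>The Laplacian of a multigraph\<close>

definition edge_mult :: "('v, 'e) mgraph \<Rightarrow> 'v \<Rightarrow> 'v \<Rightarrow> nat" where
  "edge_mult G v w = card {e \<in> edges G. ends G e = {v, w}}"

text \<open>The chips lost at \<open>v\<close> under the script that fires every vertex
  \<open>w\<close> exactly \<open>f w\<close> times, negative values meaning reversed firings: the
  script turns \<open>D\<close> into \<open>D - laplacian G f\<close>.\<close>

definition laplacian :: "('v, 'e) mgraph \<Rightarrow> ('v \<Rightarrow> int) \<Rightarrow> 'v \<Rightarrow> int" where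
  "laplacian G f v = (\<Sum>w\<in>verts G. int (edge_mult G v w) * (f v - f w))"

definition boundary :: "('v, 'e) mgraph \<Rightarrow> 'v set \<Rightarrow> 'e set" where
  "boundary G U = edges_between G U (verts G - U)"

lemma edge_mult_commute: "edge_mult G v w = edge_mult G w v"
  by (simp add: edge_mult_def insert_commute)

lemma laplacian_add: "laplacian G (\<lambda>v. f v + g v) v = laplacian G f v + laplacian G g v"
  by (simp add: laplacian_def algebra_simps flip: sum.distrib)

lemma laplacian_minus: "laplacian G (\<lambda>v. - f v) v = - laplacian G f v"
  by (simp add: laplacian_def algebra_simps flip: sum_negf)

lemma laplacian_diff: "laplacian G (\<lambda>v. f v - g v) v = laplacian G f v - laplacian G g v"
  using laplacian_add[of G f "\<lambda>v. - g v" v] by (simp add: laplacian_minus)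

lemma laplacian_const [simp]: "laplacian G (\<lambda>v. c) v = 0"
  by (simp add: laplacian_def)

text \<open>The summand is antisymmetric in \<open>v\<close> and \<open>w\<close>, so swapping the
  two sums negates the total.\<close>

lemma sum_laplacian: "(\<Sum>v\<in>verts G. laplacian G f v) = 0"
proof -
  let ?s = "\<Sum>v\<in>verts G. laplacian G f v"
  have "?s = (\<Sum>w\<in>verts G. \<Sum>v\<in>verts G. int (edge_mult G v w) * (f v - f w))"
    unfolding laplacian_def by (rule sum.swap)
  also have "\<dots> = (\<Sum>w\<in>verts G. - laplacian G f w)"
    by (auto simp: laplacian_def edge_mult_commute[of G _ w for w] algebra_simps
        simp flip: sum_negf intro!: sum.cong)
  finally show ?thesis by (simp add: sum_negf)
qed

lemma deg_diff_laplacian: "deg G (\<lambda>v. D v - laplacian G f v) = deg G D"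
  by (simp add: deg_def sum_subtractf sum_laplacian)

section \<open>Connectivity, components and egg-cuts\<close>

lemma mg_connected_stays:
  assumes "mg_connected H" "u \<in> verts H" "u \<in> X" "w \<in> verts H"
    and closed: "\<And>x y. (x, y) \<in> adj_rel H \<Longrightarrow> x \<in> X \<Longrightarrow> y \<in> X"
  shows "w \<in> X"
proof -
  have "(u, w) \<in> (adj_rel H)\<^sup>*" using assms by (auto simp: mg_connected_def)
  then show ?thesis by induction (fact \<open>u \<in> X\<close>, rule closed)
qed

lemma edge_connected_imp_connected:
  assumes "edge_connected G r A" "u \<in> A" "w \<in> A"
  shows "(u, w) \<in> (adj_rel (induced G A))\<^sup>*"
proof -
  have "mg_connected (delete_edges (induced G A) {})"
    using assms(1) unfolding edge_connected_def by (metis card.empty empty_subsetI zero_le)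
  then show ?thesis using assms(2,3)
    by (auto simp: mg_connected_def delete_edges_def induced_def)
qed

lemma edge_connected_nonempty: "edge_connected G r A \<Longrightarrow> A \<noteq> {}"
  unfolding edge_connected_def mg_connected_def
  by (drule spec[of _ "{}"]) (simp add: delete_edges_def induced_def)

text \<open>If fewer than \<open>r\<close> edges crossed, all of them could be deleted with
  \<open>B\<close> staying connected, although no surviving edge leaves \<open>U\<close>.\<close>

lemma edge_connected_crossing:
  assumes "edge_connected G r B" "r \<ge> 1" "B \<inter> U \<noteq> {}" "B - U \<noteq> {}"
  shows "r \<le> card (edges_between G (B \<inter> U) (B - U))"
proof (rule ccontr)
  let ?F = "edges_between G (B \<inter> U) (B - U)"
  let ?H = "delete_edges (induced G B) ?F"
  assume "\<not> ?thesis"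
  moreover have "?F \<subseteq> edges (induced G B)"
    by (auto simp: edges_between_def induced_def)
  ultimately have conn: "mg_connected ?H"
    using assms(1,2) unfolding edge_connected_def by auto
  obtain u w where "u \<in> B \<inter> U" "w \<in> B - U" using assms(3,4) by auto
  moreover have "verts ?H = B" by (simp add: delete_edges_def induced_def)
  moreover have "y \<in> U" if "(x, y) \<in> adj_rel ?H" "x \<in> U" for x y
    using that by (auto simp: adj_rel_def delete_edges_def induced_def edges_between_def)
  ultimately have "w \<in> U" using mg_connected_stays[OF conn, of u U w] by auto
  then show False using \<open>w \<in> B - U\<close> by simp
qed

text \<open>An edge leaving \<open>X\<close> outside \<open>F\<close> would survive and enlarge the
  component. Bounds in terms of boundaries thus transfer to arbitrary egg-cuts.\<close>

lemma boundary_component: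
  assumes "X \<in> mg_components (delete_edges G F)"
  shows "boundary G X \<subseteq> F"
proof
  fix e assume "e \<in> boundary G X"
  then obtain x y where e: "e \<in> edges G" "ends G e = {x, y}" "x \<in> X" "y \<in> verts G - X"
    by (auto simp: boundary_def edges_between_def)
  show "e \<in> F"
  proof (rule ccontr)
    assume "e \<notin> F"
    then have "(x, y) \<in> adj_rel (delete_edges G F)"
      using e by (auto simp: adj_rel_def delete_edges_def)
    then show False
      using assms e by (auto simp: mg_components_def delete_edges_def intro: rtrancl_into_rtrancl)
  qed
qed

lemma components_disjoint:
  assumes "X \<in> mg_components H" "Y \<in> mg_components H" "X \<noteq> Y"
  shows "X \<inter> Y = {}"
proof (rule ccontr)
  let ?R = "(adj_rel H)\<^sup>*"
  have sym: "(v, u) \<in> ?R" if "(u, v) \<in> ?R" for u v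
    using that sym_rtrancl[of "adj_rel H"]
    by (auto simp: sym_def adj_rel_def insert_commute)
  obtain x y where X: "X = {w \<in> verts H. (x, w) \<in> ?R}" and Y: "Y = {w \<in> verts H. (y, w) \<in> ?R}"
    using assms(1,2) by (auto simp: mg_components_def)
  assume "X \<inter> Y \<noteq> {}"
  then obtain z where "(x, z) \<in> ?R" "(y, z) \<in> ?R" using X Y by auto
  then have "(x, y) \<in> ?R" "(y, x) \<in> ?R" using sym by (meson rtrancl_trans)+
  then have "(x, w) \<in> ?R \<longleftrightarrow> (y, w) \<in> ?R" for w by (meson rtrancl_trans)
  then show False using X Y assms(3) by auto
qed

lemma component_contains_egg:
  assumes "edge_connected G r A" "A \<subseteq> verts G" "x \<in> A"
    and "\<And>e. e \<in> F \<Longrightarrow> \<not> ends G e \<subseteq> A"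
  shows "A \<subseteq> {w \<in> verts (delete_edges G F). (x, w) \<in> (adj_rel (delete_edges G F))\<^sup>*}"
proof -
  have "adj_rel (induced G A) \<subseteq> adj_rel (delete_edges G F)"
    using assms(4) by (auto simp: adj_rel_def induced_def delete_edges_def)
  then have "(adj_rel (induced G A))\<^sup>* \<subseteq> (adj_rel (delete_edges G F))\<^sup>*"
    by (rule rtrancl_mono)
  then show ?thesis
    using edge_connected_imp_connected[OF assms(1,3)] assms(2) by (auto simp: delete_edges_def)
qed

lemma is_egg_cutI:
  assumes "F \<subseteq> edges G"
    and "X \<in> mg_components (delete_edges G F)" "Y \<in> mg_components (delete_edges G F)" "X \<noteq> Y"
    and "A \<in> \<S>" "A \<subseteq> X" "B \<in> \<S>" "B \<subseteq> Y"
  shows "is_egg_cut G \<S> F"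
  using assms unfolding is_egg_cut_def by blast

text \<open>No boundary edge lies inside \<open>A\<close> or inside \<open>B\<close>, so each egg
  stays within one component; the components differ because no walk leaves \<open>U\<close> once the
  boundary is gone.\<close>

lemma boundary_is_egg_cut:
  assumes "multigraph G" "is_scramble G r \<S>" "U \<subseteq> verts G" "A \<in> \<S>" "B \<in> \<S>" "A \<inter> U = {}" "B \<subseteq> U"
  shows "is_egg_cut G \<S> (boundary G U)"
proof -
  let ?F = "boundary G U"
  let ?H = "delete_edges G ?F"
  let ?comp = "\<lambda>x. {w \<in> verts ?H. (x, w) \<in> (adj_rel ?H)\<^sup>*}"
  obtain a b where ab: "a \<in> A" "b \<in> B"
    using assms by (fastforce simp: is_scramble_def)
  have V: "A \<subseteq> verts G" "B \<subseteq> verts G" using assms by (auto simp: is_scramble_def)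
  have conn: "edge_connected G r A" "edge_connected G r B"
    using assms(2,4,5) by (auto simp: is_scramble_def)
  have F: "\<not> ends G e \<subseteq> X" if "e \<in> ?F" "X \<inter> U = {} \<or> X \<subseteq> U" for e X
    using that by (auto simp: boundary_def edges_between_def)
  have A: "A \<subseteq> ?comp a"
    using component_contains_egg[OF conn(1) V(1) ab(1)] F assms(6) by blast
  have B: "B \<subseteq> ?comp b"
    using component_contains_egg[OF conn(2) V(2) ab(2)] F assms(7) by blast
  have neq: "?comp a \<noteq> ?comp b"
  proof
    have *: "y \<in> U" if "(b, y) \<in> (adj_rel ?H)\<^sup>*" for y
      using that
    proof induction
      case (step x y)
      then obtain e where "e \<in> edges G" "e \<notin> ?F" "ends G e = {x, y}"
        by (auto simp: adj_rel_def delete_edges_def)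
      moreover from this have "y \<in> verts G" using assms(1) by (auto simp: multigraph_def)
      ultimately show ?case using step by (auto simp: boundary_def edges_between_def)
    qed (use ab assms in auto)
    assume "?comp a = ?comp b"
    then have "a \<in> ?comp b" using A ab by auto
    then have "a \<in> U" using * by (auto simp: delete_edges_def)
    then show False using ab assms by auto
  qed
  have comp: "?comp x \<in> mg_components ?H" if "x \<in> verts G" for x
    using that by (auto simp: mg_components_def delete_edges_def)
  have F_edges: "?F \<subseteq> edges G" by (auto simp: boundary_def edges_between_def)
  have verts: "a \<in> verts G" "b \<in> verts G" using ab V by auto
  show ?thesis
    by (rule is_egg_cutI[OF F_edges comp[OF verts(1)] comp[OF verts(2)] neq assms(4) A assms(5) B])
qed

section \<open>Hitting a bramble with the ends of cut edges\<close>

lemma hitting_number_le: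
  assumes "set_mset C \<subseteq> verts G" "\<And>A. A \<in> \<F> \<Longrightarrow> r \<le> size (filter_mset (\<lambda>v. v \<in> A) C)"
  shows "hitting_number G r \<F> \<le> size C"
  unfolding hitting_number_def r_intersects_def by (rule Least_le) (use assms in blast)

lemma size_filter_image_mset_set:
  "finite S \<Longrightarrow> size (filter_mset P (image_mset f (mset_set S))) = card {x \<in> S. P (f x)}"
  by (simp add: filter_mset_image_mset filter_mset_mset_set)

text \<open>\<open>B0\<close> ensures that every member inside \<open>U\<close> meets
  \<open>r\<close> cut edges, which starts the exchange; \<open>A0\<close> is the fallback when
  every cut edge has been moved outward.\<close>

lemma bramble_hitting_number_le:
  assumes fin: "finite (edges G)" and r: "r \<ge> 1" and br: "is_bramble G r \<B>"
    and A0: "A0 \<in> \<B>" "A0 \<subseteq> U" and B0: "B0 \<in> \<B>" "B0 \<inter> U = {}"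
    and U: "U \<subseteq> verts G"
  shows "hitting_number G r \<B> \<le> card (boundary G U) + r"
proof -
  let ?d = "boundary G U"
  have find: "finite ?d" using fin by (auto simp: boundary_def edges_between_def)
  have "\<forall>e\<in>?d. \<exists>u w. u \<in> U \<and> w \<in> verts G - U \<and> ends G e = {u, w}"
    by (auto simp: boundary_def edges_between_def)
  then obtain a b where ab: "\<And>e. e \<in> ?d \<Longrightarrow> a e \<in> U \<and> b e \<in> verts G - U \<and> ends G e = {a e, b e}"
    by metis
  have sub: "B \<subseteq> verts G" if "B \<in> \<B>" for B using br that by (auto simp: is_bramble_def)
  have between: "edges_between G A B \<subseteq> {e \<in> ?d. a e \<in> A \<and> b e \<in> B}"
    if "A \<subseteq> U" "B \<inter> U = {}" "B \<subseteq> verts G" for A B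
  proof
    fix e assume "e \<in> edges_between G A B"
    then obtain x y where e: "e \<in> edges G" "x \<in> A" "y \<in> B" "ends G e = {x, y}"
      by (auto simp: edges_between_def)
    then have d: "e \<in> ?d" using that unfolding boundary_def edges_between_def by blast
    then have "{x, y} = {a e, b e}" "a e \<in> U" "b e \<notin> U" using ab[of e] e by auto
    then have "x = a e \<and> y = b e" using e that by (auto simp: doubleton_eq_iff)
    then show "e \<in> {e \<in> ?d. a e \<in> A \<and> b e \<in> B}" using d e by auto
  qed
  have touch: "r \<le> card (edges_between G A B)"
    if "A \<in> \<B>" "B \<in> \<B>" "A \<subseteq> U" "B \<inter> U = {}" for A B
    using br that unfolding is_bramble_def by blast
  \<comment> \<open>\<open>S\<close> collects the edges represented by their outer end; the others
    keep their inner end.\<close>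
  define good where "good S \<longleftrightarrow> S \<subseteq> ?d \<and>
    (\<forall>A\<in>\<B>. A \<subseteq> U \<longrightarrow> r \<le> card {e \<in> ?d - S. a e \<in> A})" for S
  have "good {}"
  proof -
    have "r \<le> card {e \<in> ?d. a e \<in> A}" if "A \<in> \<B>" "A \<subseteq> U" for A
    proof -
      have "edges_between G A B0 \<subseteq> {e \<in> ?d. a e \<in> A}"
        using between[OF that(2) B0(2) sub[OF B0(1)]] by auto
      then show ?thesis
        using touch[OF that(1) B0(1) that(2) B0(2)] card_mono[of "{e \<in> ?d. a e \<in> A}"] find
        by (simp add: le_trans)
    qed
    then show ?thesis by (simp add: good_def)
  qed
  moreover have "finite {S. good S}"
    by (rule finite_subset[of _ "Pow ?d"]) (use find in \<open>auto simp: good_def\<close>)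
  ultimately obtain S where S: "good S" and max: "\<And>S'. good S' \<Longrightarrow> S \<subseteq> S' \<Longrightarrow> S' = S"
    using finite_has_maximal[of "{S. good S}"] by auto
  have Sd: "S \<subseteq> ?d" using S by (simp add: good_def)
  then have finS: "finite S" using find by (rule finite_subset)
  \<comment> \<open>If \<open>S\<close> is the whole cut, no inner end is left and any member inside
    \<open>U\<close> will do. Otherwise adding one edge breaks \<open>good\<close>; that edge
    accounts for at most one hit, so fewer than \<open>r\<close> afterwards means at most
    \<open>r\<close> before.\<close>
  obtain A1 where A1: "A1 \<in> \<B>" "A1 \<subseteq> U" "card {e \<in> ?d - S. a e \<in> A1} \<le> r"
  proof (cases "S = ?d")
    case True
    then show ?thesis using A0 that[of A0] by auto
  next
    case False
    then obtain e where e: "e \<in> ?d - S" using Sd by auto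
    then have "\<not> good (insert e S)" using max[of "insert e S"] by auto
    then obtain A where A: "A \<in> \<B>" "A \<subseteq> U" "card {f \<in> ?d - insert e S. a f \<in> A} < r"
      using e Sd by (auto simp: good_def not_le)
    have "{f \<in> ?d - S. a f \<in> A} \<subseteq> insert e {f \<in> ?d - insert e S. a f \<in> A}" by auto
    then have "card {f \<in> ?d - S. a f \<in> A} \<le> card (insert e {f \<in> ?d - insert e S. a f \<in> A})"
      by (rule card_mono[rotated]) (use find in auto)
    also have "\<dots> \<le> r" using A(3) by (auto simp: card_insert_if find)
    finally show ?thesis using A that by blast
  qed
  define T where "T = {e \<in> ?d - S. a e \<in> A1}"
  have finT: "finite T" using find by (simp add: T_def)
  define C where "C = image_mset b (mset_set S) + image_mset a (mset_set (?d - S))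
    + image_mset b (mset_set T)"
  have size: "size (filter_mset (\<lambda>v. v \<in> A) C) =
      card {e \<in> S. b e \<in> A} + card {e \<in> ?d - S. a e \<in> A} + card {e \<in> T. b e \<in> A}" for A
    using finS find finT by (simp add: C_def size_filter_image_mset_set)
  have "set_mset C \<subseteq> verts G"
    using finS find finT Sd ab U by (fastforce simp: C_def T_def)
  moreover have "r \<le> size (filter_mset (\<lambda>v. v \<in> A) C)" if "A \<in> \<B>" for A
  proof -
    consider "A \<subseteq> U" | "A \<inter> U = {}" | "A \<inter> U \<noteq> {}" "A - U \<noteq> {}" by auto
    then show ?thesis
    proof cases
      case 1
      then show ?thesis using S that unfolding good_def size by (meson le_add1 le_add2 order_trans)
    next
      case 2
      \<comment> \<open>A cut edge from \<open>A1\<close> to \<open>A\<close> is in \<open>S\<close>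
        or else, its inner end being in \<open>A1\<close>, in \<open>T\<close>; either way its outer
        end is counted in \<open>C\<close>.\<close>
      have "edges_between G A1 A \<subseteq> {e \<in> S. b e \<in> A} \<union> {e \<in> T. b e \<in> A}"
        using between[OF A1(2) 2 sub[OF that]] by (auto simp: T_def)
      then have "card (edges_between G A1 A) \<le> card ({e \<in> S. b e \<in> A} \<union> {e \<in> T. b e \<in> A})"
        by (rule card_mono[rotated]) (use finS finT in auto)
      also have "\<dots> \<le> card {e \<in> S. b e \<in> A} + card {e \<in> T. b e \<in> A}" by (rule card_Un_le)
      finally show ?thesis unfolding size using touch[OF A1(1) that A1(2) 2] by linarith
    next
      case 3
      \<comment> \<open>Both ends of such an edge lie in \<open>A\<close>, so it counts whichever
        end was chosen.\<close>
      have "edges_between G (A \<inter> U) (A - U) \<subseteq> {e \<in> S. b e \<in> A} \<union> {e \<in> ?d - S. a e \<in> A}"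
        using between[of "A \<inter> U" "A - U"] sub[OF that] by auto
      then have "card (edges_between G (A \<inter> U) (A - U))
          \<le> card ({e \<in> S. b e \<in> A} \<union> {e \<in> ?d - S. a e \<in> A})"
        by (rule card_mono[rotated]) (use finS find in auto)
      also have "\<dots> \<le> card {e \<in> S. b e \<in> A} + card {e \<in> ?d - S. a e \<in> A}" by (rule card_Un_le)
      finally show ?thesis
        unfolding size using edge_connected_crossing[of G r A U] 3 r br that
        by (fastforce simp: is_bramble_def)
    qed
  qed
  ultimately have "hitting_number G r \<B> \<le> size C" by (rule hitting_number_le)
  also have "size C = card S + card (?d - S) + card T" by (simp add: C_def)
  also have "card S + card (?d - S) = card ?d"
    using card_Diff_subset[OF finS Sd] card_mono[OF find Sd] by simp
  also have "card T \<le> r" using A1 by (simp add: T_def)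
  finally show ?thesis by simp
qed

section \<open>Chip-firing through the Laplacian\<close>

lemma edge_mult_self: "multigraph G \<Longrightarrow> edge_mult G v v = 0"
  by (auto simp: multigraph_def edge_mult_def)

lemma laplacian_cong:
  "(\<And>w. w \<in> verts G \<Longrightarrow> f w = g w) \<Longrightarrow> v \<in> verts G \<Longrightarrow> laplacian G f v = laplacian G g v"
  by (simp add: laplacian_def)

text \<open>As \<open>X\<close> and \<open>Y\<close> are disjoint, an edge determines which of its
  ends lies in \<open>X\<close>, so the double sum counts it once.\<close>

lemma card_edges_between:
  assumes "finite (edges G)" "finite X" "finite Y" "X \<inter> Y = {}"
  shows "card (edges_between G X Y) = (\<Sum>v\<in>X. \<Sum>w\<in>Y. edge_mult G v w)"
proof -
  let ?E = "\<lambda>p. {e \<in> edges G. ends G e = {fst p, snd p}}"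
  have "edges_between G X Y = (\<Union>p\<in>X \<times> Y. ?E p)"
    unfolding edges_between_def by fastforce
  also have "card \<dots> = (\<Sum>p\<in>X \<times> Y. card (?E p))"
    by (rule card_UN_disjoint) (use assms in \<open>auto simp: doubleton_eq_iff\<close>)
  also have "\<dots> = (\<Sum>v\<in>X. \<Sum>w\<in>Y. edge_mult G v w)"
    by (simp add: sum.cartesian_product edge_mult_def case_prod_beta)
  finally show ?thesis .
qed

lemma val_eq_sum_edge_mult:
  assumes G: "multigraph G" and v: "v \<in> verts G"
  shows "val G v = (\<Sum>w\<in>verts G. edge_mult G v w)"
proof -
  have "{e \<in> edges G. v \<in> ends G e} = (\<Union>w\<in>verts G. {e \<in> edges G. ends G e = {v, w}})"
  proof (intro equalityI subsetI)
    fix e assume e: "e \<in> {e \<in> edges G. v \<in> ends G e}"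
    then have "card (ends G e) = 2" "ends G e \<subseteq> verts G" using G by (auto simp: multigraph_def)
    then obtain x y where "ends G e = {x, y}" by (auto simp: card_2_iff)
    then have "\<exists>w. ends G e = {v, w}" using e by auto
    then show "e \<in> (\<Union>w\<in>verts G. {e \<in> edges G. ends G e = {v, w}})"
      using e \<open>ends G e \<subseteq> verts G\<close> by auto
  qed auto
  also have "card \<dots> = (\<Sum>w\<in>verts G. edge_mult G v w)"
    unfolding edge_mult_def
    by (rule card_UN_disjoint) (use G in \<open>auto simp: multigraph_def doubleton_eq_iff\<close>)
  finally show ?thesis by (simp add: val_def)
qed

lemma laplacian_indicator_in:
  assumes "finite (verts G)" "v \<in> U"
  shows "laplacian G (\<lambda>u. of_bool (u \<in> U)) v = (\<Sum>w\<in>verts G - U. int (edge_mult G v w))"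
  unfolding laplacian_def
  by (rule sum.mono_neutral_cong_right) (use assms in auto)

lemma laplacian_indicator_notin:
  assumes "finite (verts G)" "v \<notin> U" "U \<subseteq> verts G"
  shows "laplacian G (\<lambda>u. of_bool (u \<in> U)) v = - (\<Sum>w\<in>U. int (edge_mult G v w))"
  unfolding laplacian_def sum_negf[symmetric]
  by (rule sum.mono_neutral_cong_right) (use assms in auto)

text \<open>The two indicators add up to a constant on the vertices: firing the complement undoes
  firing \<open>U\<close>.\<close>

lemma laplacian_complement:
  assumes "v \<in> verts G"
  shows "laplacian G (\<lambda>u. of_bool (u \<in> verts G - U)) v = - laplacian G (\<lambda>u. of_bool (u \<in> U)) v"
proof -
  have "laplacian G (\<lambda>u. of_bool (u \<in> verts G - U)) v = laplacian G (\<lambda>u. 1 - of_bool (u \<in> U)) v"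
    by (rule laplacian_cong) (use assms in auto)
  then show ?thesis by (simp add: laplacian_diff)
qed

text \<open>Writing the script as the indicator of \<open>{v}\<close> makes a single firing an
  instance of firing a set.\<close>

lemma fire_eq_laplacian:
  assumes G: "multigraph G" and v: "v \<in> verts G"
  shows "fire G v D = (\<lambda>w. D w - laplacian G (\<lambda>u. of_bool (u \<in> {v})) w)"
proof
  fix w
  have fin: "finite (verts G)" using G by (simp add: multigraph_def)
  show "fire G v D w = D w - laplacian G (\<lambda>u. of_bool (u \<in> {v})) w"
  proof (cases "w = v")
    case True
    have "val G v = (\<Sum>w\<in>verts G - {v}. edge_mult G v w)"
      unfolding val_eq_sum_edge_mult[OF G v]
      by (rule sum.mono_neutral_right) (use fin edge_mult_self[OF G] in auto)
    then have "laplacian G (\<lambda>u. of_bool (u \<in> {v})) v = int (val G v)"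
      using laplacian_indicator_in[OF fin, of v "{v}"] by simp
    then show ?thesis by (simp only: fire_def True if_True simp_thms)
  next
    case False
    then have "laplacian G (\<lambda>u. of_bool (u \<in> {v})) w = - int (edge_mult G v w)"
      using laplacian_indicator_notin[OF fin, of w "{v}"] v by (simp add: edge_mult_commute[of G w v])
    then show ?thesis using False by (simp add: fire_def edge_mult_def)
  qed
qed

text \<open>Along a chain of firings, a forward one adds the indicator of a vertex to the script and
  a reversed one subtracts it.\<close>

lemma lin_equiv_imp_laplacian:
  assumes G: "multigraph G" and "lin_equiv G D D'"
  shows "\<exists>f. D' = (\<lambda>v. D v - laplacian G f v)"
  using assms(2) unfolding lin_equiv_def
proof (induction rule: equivclp_induct)
  case base
  show ?case by (rule exI[of _ "\<lambda>_. 0"]) simp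
next
  case (step D' D'')
  then obtain f where f: "D' = (\<lambda>v. D v - laplacian G f v)" by blast
  from step(2) show ?case
  proof
    assume "\<exists>v\<in>verts G. D'' = fire G v D'"
    then obtain v where "D'' = (\<lambda>w. D' w - laplacian G (\<lambda>u. of_bool (u \<in> {v})) w)"
      using fire_eq_laplacian[OF G] by blast
    then have "D'' = (\<lambda>w. D w - laplacian G (\<lambda>u. f u + of_bool (u \<in> {v})) w)"
      by (simp add: f laplacian_add algebra_simps)
    then show ?thesis by blast
  next
    assume "\<exists>v\<in>verts G. D' = fire G v D''"
    then obtain v where "D' = (\<lambda>w. D'' w - laplacian G (\<lambda>u. of_bool (u \<in> {v})) w)"
      using fire_eq_laplacian[OF G] by blast
    then have "D'' = (\<lambda>w. D' w + laplacian G (\<lambda>u. of_bool (u \<in> {v})) w)"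
      by simp
    then have "D'' = (\<lambda>w. D w - laplacian G (\<lambda>u. f u - of_bool (u \<in> {v})) w)"
      by (simp only: f laplacian_diff algebra_simps)
    then show ?thesis by blast
  qed
qed

section \<open>Firing sets of vertices and the eggs hit\<close>

text \<open>If \<open>A \<subseteq> U\<close>, its vertices only lose chips. If \<open>A\<close>
  crosses \<open>U\<close>, at least \<open>r\<close> edges within \<open>A\<close> carry a chip out
  of \<open>A \<inter> U\<close>; as \<open>D'\<close> is nonnegative, \<open>D\<close> had these
  chips on \<open>A\<close> already.\<close>

lemma fire_set_gain:
  assumes G: "multigraph G" and r: "r \<ge> 1"
    and A: "edge_connected G r A" "A \<subseteq> verts G" and U: "U \<subseteq> verts G"
    and D: "\<And>v. v \<in> verts G \<Longrightarrow> 0 \<le> D v"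
    and D': "\<And>v. v \<in> verts G \<Longrightarrow> D' v = D v - laplacian G (\<lambda>u. of_bool (u \<in> U)) v"
      "\<And>v. v \<in> verts G \<Longrightarrow> 0 \<le> D' v"
    and less: "(\<Sum>v\<in>A. D v) < int r" and ge: "int r \<le> (\<Sum>v\<in>A. D' v)"
  shows "A \<inter> U = {}"
proof (rule ccontr)
  let ?L = "laplacian G (\<lambda>u. of_bool (u \<in> U))"
  assume ne: "A \<inter> U \<noteq> {}"
  have fin: "finite (verts G)" "finite (edges G)" using G by (auto simp: multigraph_def)
  then have finA: "finite A" using A(2) by (auto intro: finite_subset)
  show False
  proof (cases "A \<subseteq> U")
    case True
    have "(\<Sum>v\<in>A. D' v) \<le> (\<Sum>v\<in>A. D v)"
    proof (rule sum_mono)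
      fix v assume "v \<in> A"
      then have "?L v \<ge> 0" using True laplacian_indicator_in[OF fin(1), of v U]
        by (metis of_nat_0_le_iff subsetD sum_nonneg)
      then show "D' v \<le> D v" using D'(1)[of v] A(2) \<open>v \<in> A\<close> by auto
    qed
    then show False using less ge by simp
  next
    case False
    have "int r \<le> int (card (edges_between G (A \<inter> U) (A - U)))"
      using edge_connected_crossing[OF A(1) r ne] False by simp
    also have "\<dots> = (\<Sum>v\<in>A \<inter> U. \<Sum>w\<in>A - U. int (edge_mult G v w))"
      using fin finA by (subst card_edges_between) auto
    also have "\<dots> \<le> (\<Sum>v\<in>A \<inter> U. ?L v)"
    proof (rule sum_mono)
      fix v assume "v \<in> A \<inter> U"
      then have "?L v = (\<Sum>w\<in>verts G - U. int (edge_mult G v w))"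
        using laplacian_indicator_in[OF fin(1)] by blast
      moreover have "(\<Sum>w\<in>A - U. int (edge_mult G v w)) \<le> \<dots>"
        by (rule sum_mono2) (use fin A in auto)
      ultimately show "(\<Sum>w\<in>A - U. int (edge_mult G v w)) \<le> ?L v" by simp
    qed
    also have "\<dots> \<le> (\<Sum>v\<in>A \<inter> U. D v)"
    proof (rule sum_mono)
      fix v assume "v \<in> A \<inter> U"
      then show "?L v \<le> D v" using D'(1)[of v] D'(2)[of v] A(2) by auto
    qed
    also have "\<dots> \<le> (\<Sum>v\<in>A. D v)"
      by (rule sum_mono2) (use finA D A in auto)
    finally show False using less by simp
  qed
qed

text \<open>Time reversal of \<open>fire_set_gain\<close>: \<open>D\<close> arises from
  \<open>D'\<close> by firing the complement of \<open>U\<close>.\<close>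

lemma fire_set_loss:
  assumes G: "multigraph G" and r: "r \<ge> 1"
    and A: "edge_connected G r A" "A \<subseteq> verts G" and U: "U \<subseteq> verts G"
    and D: "\<And>v. v \<in> verts G \<Longrightarrow> 0 \<le> D v"
    and D': "\<And>v. v \<in> verts G \<Longrightarrow> D' v = D v - laplacian G (\<lambda>u. of_bool (u \<in> U)) v"
      "\<And>v. v \<in> verts G \<Longrightarrow> 0 \<le> D' v"
    and less: "(\<Sum>v\<in>A. D' v) < int r" and ge: "int r \<le> (\<Sum>v\<in>A. D v)"
  shows "A \<subseteq> U"
proof -
  have "D v = D' v - laplacian G (\<lambda>u. of_bool (u \<in> verts G - U)) v" if "v \<in> verts G" for v
    using that D'(1) by (simp only: laplacian_complement diff_minus_eq_add diff_add_cancel)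
  then have "A \<inter> (verts G - U) = {}"
    using fire_set_gain[OF G r A _ D'(2) _ D less ge, of "verts G - U"] by blast
  then show ?thesis using A(2) by blast
qed

text \<open>Firing \<open>U\<close> sends one chip along each boundary edge, and no vertex of
  \<open>U\<close> goes into debt, so \<open>D\<close> has all these chips on
  \<open>U\<close>.\<close>

lemma card_boundary_le_deg:
  assumes G: "multigraph G" and U: "U \<subseteq> verts G"
    and D: "\<And>v. v \<in> verts G \<Longrightarrow> 0 \<le> D v"
    and D': "\<And>v. v \<in> verts G \<Longrightarrow> 0 \<le> D v - laplacian G (\<lambda>u. of_bool (u \<in> U)) v"
  shows "int (card (boundary G U)) \<le> deg G D"
proof -
  have fin: "finite (verts G)" "finite (edges G)" using G by (auto simp: multigraph_def)
  then have finU: "finite U" using U by (auto intro: finite_subset)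
  have "int (card (boundary G U)) = (\<Sum>v\<in>U. \<Sum>w\<in>verts G - U. int (edge_mult G v w))"
    unfolding boundary_def using fin finU by (subst card_edges_between) auto
  also have "\<dots> = (\<Sum>v\<in>U. laplacian G (\<lambda>u. of_bool (u \<in> U)) v)"
    using laplacian_indicator_in[OF fin(1), of _ U] by (intro sum.cong) auto
  also have "\<dots> \<le> (\<Sum>v\<in>U. D v)"
    by (rule sum_mono) (use D' U in force)
  also have "\<dots> \<le> deg G D"
    unfolding deg_def by (rule sum_mono2) (use fin U D in auto)
  finally show ?thesis .
qed

text \<open>The scripts \<open>max (f - c) 0\<close>, for decreasing \<open>c\<close>, interpolate between \<open>0\<close> and \<open>f\<close> (up to a constant);
  consecutive ones differ by firing the superlevel set \<open>{c \<le> f}\<close>.\<close>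

lemma level_script_effective:
  assumes v: "0 \<le> D v" "0 \<le> D v - laplacian G f v"
  shows "0 \<le> D v - laplacian G (\<lambda>u. max (f u - c) 0) v"
proof (cases "f v \<le> c")
  case True
  \<comment> \<open>The truncated script is minimal at \<open>v\<close>, so \<open>v\<close> loses
    no chips.\<close>
  then have "laplacian G (\<lambda>u. max (f u - c) 0) v \<le> 0"
    unfolding laplacian_def by (intro sum_nonpos mult_nonneg_nonpos) auto
  then show ?thesis using v by simp
next
  case False
  \<comment> \<open>Truncation can only raise other vertices relative to \<open>v\<close>, so
    \<open>v\<close> loses at most as many chips as under \<open>f\<close>.\<close>
  then have "laplacian G (\<lambda>u. max (f u - c) 0) v \<le> laplacian G f v"
    unfolding laplacian_def by (intro sum_mono mult_left_mono) auto
  then show ?thesis using v by simp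
qed

lemma level_script_step:
  assumes "v \<in> verts G"
  shows "laplacian G (\<lambda>u. max (f u - (c - 1)) 0) v =
    laplacian G (\<lambda>u. max (f u - c) 0) v + laplacian G (\<lambda>u. of_bool (u \<in> {u \<in> verts G. c \<le> f u})) v"
  unfolding laplacian_add[symmetric] by (rule laplacian_cong) (use assms in auto)

text \<open>\<open>reach\<close> is what rank at least \<open>r\<close> provides;
  \<open>miss\<close> says that no script leads to an effective divisor with \<open>r\<close> chips
  on every egg.\<close>

lemma scramble_egg_cut:
  assumes G: "multigraph G" and r: "r \<ge> 1" and scr: "is_scramble G r \<S>"
    and D: "\<And>v. v \<in> verts G \<Longrightarrow> 0 \<le> D v"
    and reach: "\<And>v. v \<in> verts G \<Longrightarrow> \<exists>f. (\<forall>w\<in>verts G. 0 \<le> D w - laplacian G f w) \<and>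
      int r \<le> D v - laplacian G f v"
    and miss: "\<And>f. (\<forall>w\<in>verts G. 0 \<le> D w - laplacian G f w) \<Longrightarrow>
      \<exists>A\<in>\<S>. (\<Sum>v\<in>A. D v - laplacian G f v) < int r"
  shows "\<exists>F. is_egg_cut G \<S> F \<and> int (card F) \<le> deg G D"
proof -
  have fin: "finite (verts G)" "finite (edges G)" using G by (auto simp: multigraph_def)
  have egg: "edge_connected G r A" "A \<subseteq> verts G" "A \<noteq> {}" if "A \<in> \<S>" for A
    using scr that by (auto simp: is_scramble_def)
  have finS: "finite \<S>" by (rule finite_subset[of _ "Pow (verts G)"]) (use egg fin in auto)
  define eff where "eff f \<longleftrightarrow> (\<forall>w\<in>verts G. 0 \<le> D w - laplacian G f w)" for f
  define eggs where "eggs f = {A \<in> \<S>. int r \<le> (\<Sum>v\<in>A. D v - laplacian G f v)}" for f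
  have fine: "finite (eggs f)" for f using finS by (simp add: eggs_def)
  have "eff (\<lambda>_. 0)" using D by (simp add: eff_def)
  moreover have "\<forall>f. eff f \<longrightarrow> card (eggs f) < Suc (card \<S>)"
    using card_mono[OF finS] by (auto simp: eggs_def less_Suc_eq_le)
  \<comment> \<open>Scripts form an infinite set, but the number of eggs hit is at most
    \<open>card \<S>\<close>.\<close>
  ultimately obtain f where f: "eff f" and max: "\<And>g. eff g \<Longrightarrow> card (eggs g) \<le> card (eggs f)"
    using ex_has_greatest_nat[of eff "\<lambda>_. 0" "\<lambda>f. card (eggs f)"] by blast
  obtain A where A: "A \<in> \<S>" "(\<Sum>v\<in>A. D v - laplacian G f v) < int r"
    using miss f unfolding eff_def by blast
  obtain a where a: "a \<in> A" "a \<in> verts G" using egg A(1) by blast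
  obtain h where h: "eff h" "int r \<le> D a - laplacian G h a"
    using reach[OF a(2)] unfolding eff_def by blast
  \<comment> \<open>Firing \<open>g\<close> leads from the divisor of \<open>f\<close> to that of
    \<open>h\<close>. The truncations \<open>lev\<close> do so in steps, starting at
    \<open>f\<close>, as \<open>g\<close> never exceeds \<open>M\<close>, and ending at
    \<open>h\<close> up to the constant \<open>m\<close>.\<close>
  define g where "g u = h u - f u" for u
  define M where "M = Max (g ` verts G)"
  define m where "m = Min (g ` verts G)"
  have Mm: "g v \<le> M" "m \<le> g v" if "v \<in> verts G" for v
    using that fin by (auto simp: M_def m_def)
  define lev where "lev i u = f u + max (g u - (M - int i)) 0" for i u
  define Di where "Di i v = D v - laplacian G (lev i) v" for i v
  define U where "U i = {u \<in> verts G. M - int i \<le> g u}" for i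
  have lap_lev: "laplacian G (lev i) v = laplacian G f v + laplacian G (\<lambda>u. max (g u - (M - int i)) 0) v"
    for i v unfolding lev_def by (rule laplacian_add)
  have eff_lev: "eff (lev i)" for i
    unfolding eff_def
  proof
    fix v assume v: "v \<in> verts G"
    have "laplacian G g v = laplacian G h v - laplacian G f v"
      unfolding g_def by (rule laplacian_diff)
    then show "0 \<le> D v - laplacian G (lev i) v"
      using level_script_effective[of "\<lambda>v. D v - laplacian G f v" v G g "M - int i"] f h(1) v
      by (simp add: lap_lev eff_def)
  qed
  then have Di_nonneg: "0 \<le> Di i v" if "v \<in> verts G" for i v
    using that by (auto simp: Di_def eff_def)
  have Di_step: "Di (Suc i) v = Di i v - laplacian G (\<lambda>u. of_bool (u \<in> U i)) v"
    if "v \<in> verts G" for i v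
  proof -
    have *: "M - int (Suc i) = (M - int i) - 1" by simp
    show ?thesis unfolding Di_def lap_lev * level_script_step[OF that] U_def by simp
  qed
  have UV: "U i \<subseteq> verts G" for i by (auto simp: U_def)
  have U_mono: "U i \<subseteq> U j" if "i \<le> j" for i j using that by (auto simp: U_def)
  have eggs_lev: "B \<in> eggs (lev i) \<longleftrightarrow> B \<in> \<S> \<and> int r \<le> (\<Sum>v\<in>B. Di i v)" for B i
    by (simp add: eggs_def Di_def)
  have lev0: "eggs (lev 0) = eggs f"
  proof -
    have "laplacian G (lev 0) v = laplacian G f v" if "v \<in> verts G" for v
      by (rule laplacian_cong) (use that Mm in \<open>auto simp: lev_def max_def\<close>)
    then have "(\<Sum>v\<in>B. D v - laplacian G (lev 0) v) = (\<Sum>v\<in>B. D v - laplacian G f v)"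
      if "B \<in> \<S>" for B using egg(2)[OF that] by (intro sum.cong) auto
    then show ?thesis by (auto simp: eggs_def)
  qed
  define N where "N = nat (M - m)"
  have "A \<in> eggs (lev N)"
  proof -
    have "int N = M - m" using Mm[OF a(2)] by (simp add: N_def)
    then have "laplacian G (lev N) a = laplacian G (\<lambda>u. h u - m) a"
      by (intro laplacian_cong) (use a Mm in \<open>auto simp: lev_def g_def\<close>)
    then have "int r \<le> Di N a" using h(2) by (simp add: Di_def laplacian_diff)
    also have "\<dots> \<le> (\<Sum>v\<in>A. Di N v)"
      by (rule member_le_sum) (use a Di_nonneg egg[OF A(1)] fin in \<open>auto intro: finite_subset\<close>)
    finally show ?thesis using A by (simp add: eggs_lev)
  qed
  moreover have A0: "A \<notin> eggs (lev 0)" unfolding lev0 using A by (simp add: eggs_def)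
  \<comment> \<open>The chain starts without \<open>A\<close> and reaches it, so the firing of some
    \<open>U k\<close> gains \<open>A\<close>.\<close>
  ultimately obtain k where k: "A \<notin> eggs (lev k)" "A \<in> eggs (lev (Suc k))"
    using ex_least_nat_less[of "\<lambda>i. A \<in> eggs (lev i)" N] by auto
  \<comment> \<open>Otherwise stage \<open>Suc k\<close> would hit \<open>A\<close> besides every
    egg hit by \<open>f\<close>, against maximality.\<close>
  have "\<not> eggs (lev 0) \<subseteq> eggs (lev (Suc k))"
  proof
    assume "eggs (lev 0) \<subseteq> eggs (lev (Suc k))"
    then have "eggs (lev 0) \<subset> eggs (lev (Suc k))" using A0 k by blast
    then have "card (eggs (lev 0)) < card (eggs (lev (Suc k)))" by (rule psubset_card_mono[OF fine])
    then show False using max[OF eff_lev, of "Suc k"] lev0 by simp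
  qed
  then obtain B where B: "B \<in> eggs (lev 0)" "B \<notin> eggs (lev (Suc k))" by blast
  \<comment> \<open>\<open>B\<close> is lost at a stage \<open>i \<le> k\<close>; the fired sets
    increase, so \<open>U k\<close> contains \<open>B\<close> as well.\<close>
  then obtain i where i: "i < Suc k" "B \<in> eggs (lev i)" "B \<notin> eggs (lev (Suc i))"
    using ex_least_nat_less[of "\<lambda>i. B \<notin> eggs (lev i)" "Suc k"] by auto
  have BS: "B \<in> \<S>" using B by (simp add: eggs_def)
  have "B \<subseteq> U i"
    using fire_set_loss[OF G r egg(1,2)[OF BS] UV Di_nonneg Di_step Di_nonneg] i BS
    by (simp add: eggs_lev not_le)
  then have "B \<subseteq> U k" using U_mono[of i k] i by auto
  moreover have "A \<inter> U k = {}"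
    using fire_set_gain[OF G r egg(1,2)[OF A(1)] UV Di_nonneg Di_step Di_nonneg] k A(1)
    by (simp add: eggs_lev not_le)
  ultimately have "is_egg_cut G \<S> (boundary G (U k))"
    using boundary_is_egg_cut[OF G scr UV A(1) BS] by blast
  moreover have "int (card (boundary G (U k))) \<le> deg G (Di k)"
    by (rule card_boundary_le_deg[OF G UV Di_nonneg]) (use Di_step Di_nonneg in \<open>metis\<close>)+
  moreover have "deg G (Di k) = deg G D" unfolding Di_def by (rule deg_diff_laplacian)
  ultimately show ?thesis by auto
qed

section \<open>Divisors as multisets, rank and gonality\<close>

lemma filter_replicate_mset: "filter_mset P (replicate_mset n x) = (if P x then replicate_mset n x else {#})"
  by (induction n) auto

lemma size_filter_sum_replicate_mset:
  "finite V \<Longrightarrow> size (filter_mset P (\<Sum>v\<in>V. replicate_mset (n v) v)) = (\<Sum>v\<in>V. if P v then n v else 0)"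
  by (induction rule: finite_induct) (auto simp: filter_replicate_mset)

text \<open>An effective divisor, read as a multiset with \<open>D v\<close> copies of
  \<open>v\<close>, meets \<open>A\<close> as often as it has chips there.\<close>

lemma hitting_number_le_deg:
  assumes fin: "finite (verts G)" and D: "\<And>v. v \<in> verts G \<Longrightarrow> 0 \<le> D v"
    and \<F>: "\<And>A. A \<in> \<F> \<Longrightarrow> A \<subseteq> verts G \<and> int r \<le> (\<Sum>v\<in>A. D v)"
  shows "int (hitting_number G r \<F>) \<le> deg G D"
proof -
  define C where "C = (\<Sum>v\<in>verts G. replicate_mset (nat (D v)) v)"
  have "set_mset C \<subseteq> verts G" using fin by (auto simp: C_def set_mset_sum split: if_splits)
  moreover have "r \<le> size (filter_mset (\<lambda>v. v \<in> A) C)" if "A \<in> \<F>" for A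
  proof -
    have "size (filter_mset (\<lambda>v. v \<in> A) C) = (\<Sum>v\<in>A. nat (D v))"
      unfolding C_def size_filter_sum_replicate_mset[OF fin]
      by (rule sum.mono_neutral_cong_right) (use fin \<F>[OF that] in auto)
    moreover have "int (\<Sum>v\<in>A. nat (D v)) = (\<Sum>v\<in>A. D v)"
      unfolding of_nat_sum by (rule sum.cong) (use \<F>[OF that] D in auto)
    ultimately show ?thesis using \<F>[OF that] by linarith
  qed
  ultimately have "hitting_number G r \<F> \<le> size C" by (rule hitting_number_le)
  moreover have "size C = (\<Sum>v\<in>verts G. nat (D v))"
    using size_filter_sum_replicate_mset[OF fin, of "\<lambda>_. True"] by (simp add: C_def)
  moreover have "int (\<Sum>v\<in>verts G. nat (D v)) = deg G D"
    unfolding of_nat_sum deg_def by (rule sum.cong) (use D in auto)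
  ultimately show ?thesis by linarith
qed

text \<open>The condition maximised in \<open>rank\<close>, named so that it can be shown bounded
  and \<open>GREATEST\<close> evaluated.\<close>

definition subtractable :: "('v, 'e) mgraph \<Rightarrow> ('v \<Rightarrow> int) \<Rightarrow> nat \<Rightarrow> bool" where
  "subtractable G D k \<longleftrightarrow>
     (\<forall>E. is_effective G E \<and> deg G E = int k \<longrightarrow> equiv_effective G (\<lambda>v. D v - E v))"

lemma equiv_effectiveE:
  assumes "multigraph G" "equiv_effective G D"
  obtains f where "\<And>v. v \<in> verts G \<Longrightarrow> 0 \<le> D v - laplacian G f v"
  using assms lin_equiv_imp_laplacian[OF assms(1)]
  unfolding equiv_effective_def is_effective_def by metis

lemma effective_equiv_effective: "is_effective G D \<Longrightarrow> equiv_effective G D"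
  unfolding equiv_effective_def lin_equiv_def by (meson equivclp_refl)

text \<open>A script that makes \<open>D\<close> effective after removing \<open>k\<close> chips at
  \<open>v\<close> puts \<open>k\<close> chips on \<open>v\<close> when applied to \<open>D\<close>
  itself. The degree bound caps the numbers over which \<open>rank\<close> maximises.\<close>

lemma subtractable_point:
  assumes G: "multigraph G" and sub: "subtractable G D k" and v: "v \<in> verts G"
  obtains f where "\<And>w. w \<in> verts G \<Longrightarrow> 0 \<le> D w - laplacian G f w" "int k \<le> D v - laplacian G f v"
    "int k \<le> deg G D"
proof -
  have fin: "finite (verts G)" using G by (simp add: multigraph_def)
  let ?E = "\<lambda>w. if w = v then int k else 0"
  have "is_effective G ?E" using v by (auto simp: is_effective_def is_divisor_def)
  moreover have "deg G ?E = int k" using v fin by (simp add: deg_def)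
  ultimately have "equiv_effective G (\<lambda>w. D w - ?E w)"
    using sub by (simp add: subtractable_def)
  then obtain f where f: "\<And>w. w \<in> verts G \<Longrightarrow> 0 \<le> D w - ?E w - laplacian G f w"
    by (rule equiv_effectiveE[OF G]) blast
  have nonneg: "0 \<le> D w - laplacian G f w" if "w \<in> verts G" for w
    using f[OF that] by (auto split: if_splits)
  have k: "int k \<le> D v - laplacian G f v" using f[OF v] by simp
  also have "\<dots> \<le> deg G (\<lambda>w. D w - laplacian G f w)"
    unfolding deg_def by (rule member_le_sum) (use v fin nonneg in auto)
  finally have "int k \<le> deg G D" by (simp add: deg_diff_laplacian)
  then show thesis using that nonneg k by blast
qed

lemma subtractable_le_deg:
  assumes "multigraph G" "subtractable G D k"
  shows "k \<le> nat (deg G D)"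
proof -
  obtain v where "v \<in> verts G" using assms(1) by (auto simp: multigraph_def mg_connected_def)
  then show ?thesis by (rule subtractable_point[OF assms]) linarith
qed

text \<open>The witness \<open>k\<close> is the maximum itself and may exceed \<open>r\<close>; this
  suffices, as \<open>k\<close> chips on a vertex include \<open>r\<close>.\<close>

lemma le_rankD:
  assumes G: "multigraph G" and rank: "int r \<le> rank G D"
  obtains k where "equiv_effective G D" "subtractable G D k" "r \<le> k"
proof -
  have eq: "equiv_effective G D" using rank by (auto simp: rank_def split: if_splits)
  \<comment> \<open>The only effective divisor of degree 0 is 0, so the maximum is over a nonempty
    set.\<close>
  have "subtractable G D 0" unfolding subtractable_def
  proof (intro allI impI)
    fix E assume E: "is_effective G E \<and> deg G E = int 0"
    then have "E v = 0" for v
      using G sum_nonneg_eq_0_iff[of "verts G" E]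
      by (cases "v \<in> verts G") (auto simp: multigraph_def is_effective_def is_divisor_def deg_def)
    then show "equiv_effective G (\<lambda>v. D v - E v)" using eq by simp
  qed
  then have "subtractable G D (GREATEST k. subtractable G D k)"
    using subtractable_le_deg[OF G] by (rule GreatestI_nat)
  moreover have "r \<le> (GREATEST k. subtractable G D k)"
    using rank eq by (simp add: rank_def subtractable_def)
  ultimately show thesis using that eq by blast
qed

lemma le_rankI:
  assumes "multigraph G" "equiv_effective G D" "subtractable G D r"
  shows "int r \<le> rank G D"
proof -
  have "r \<le> (GREATEST k. subtractable G D k)"
    using assms(3) subtractable_le_deg[OF assms(1)] by (rule Greatest_le_nat)
  then show ?thesis using assms(2) by (simp add: rank_def subtractable_def)
qed

text \<open>\<open>int\<close> is not well-ordered, so \<open>LEAST\<close> needs care: the degrees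
  in question are nonnegative, and the minimum is taken in \<open>nat\<close> and transferred
  back.\<close>

lemma gonality_attained:
  assumes G: "multigraph G"
  obtains D where "int r \<le> rank G D" "deg G D = gonality G r"
proof -
  define Q where "Q d \<longleftrightarrow> (\<exists>D. is_divisor G D \<and> int r \<le> rank G D \<and> deg G D = d)" for d
  have fin: "finite (verts G)" using G by (simp add: multigraph_def)
  have nonneg: "0 \<le> d" if "Q d" for d
  proof -
    obtain D where D: "int r \<le> rank G D" "deg G D = d" using \<open>Q d\<close> by (auto simp: Q_def)
    obtain k where k: "subtractable G D k" by (rule le_rankD[OF G D(1)])
    obtain v where "v \<in> verts G" using G by (auto simp: multigraph_def mg_connected_def)
    then have "int k \<le> deg G D" by (rule subtractable_point[OF G k])
    then show ?thesis using D(2) by simp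
  qed
  \<comment> \<open>With \<open>r\<close> chips on every vertex, any effective divisor of degree
    \<open>r\<close> can be subtracted outright, having at most \<open>r\<close> chips
    anywhere.\<close>
  let ?D = "\<lambda>v. if v \<in> verts G then int r else 0"
  have "is_effective G ?D" by (simp add: is_effective_def is_divisor_def)
  moreover have "subtractable G ?D r" unfolding subtractable_def
  proof (intro allI impI effective_equiv_effective)
    fix E assume E: "is_effective G E \<and> deg G E = int r"
    then have "E v \<le> int r" if "v \<in> verts G" for v
      using member_le_sum[of v "verts G" E] that fin by (auto simp: is_effective_def deg_def)
    then show "is_effective G (\<lambda>v. ?D v - E v)" using E by (auto simp: is_effective_def is_divisor_def)
  qed
  ultimately have "Q (deg G ?D)"
    using le_rankI[OF G effective_equiv_effective] by (auto simp: Q_def is_effective_def)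
  then have "Q (int (nat (deg G ?D)))" using nonneg by simp
  then have least: "Q (int (LEAST n. Q (int n)))" by (rule LeastI)
  have "(LEAST d. Q d) = int (LEAST n. Q (int n))"
  proof (rule Least_equality)
    show "Q (int (LEAST n. Q (int n)))" by (fact least)
    fix d assume d: "Q d"
    then have "(LEAST n. Q (int n)) \<le> nat d" using nonneg by (intro Least_le) simp
    then show "int (LEAST n. Q (int n)) \<le> d" using nonneg[OF d] by linarith
  qed
  then have "Q (gonality G r)" using least by (simp add: gonality_def Q_def)
  then show thesis using that by (auto simp: Q_def)
qed

section \<open>Comparing the three invariants\<close>

text \<open>The minimum is finite because the hitting number is, so \<open>the_enat\<close> loses
  nothing.\<close>

lemma enat_scramble_order:
  "enat (scramble_order G r \<S>) = min (enat (hitting_number G r \<S>)) (egg_cut_number G \<S>)"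
  unfolding scramble_order_def by (cases "egg_cut_number G \<S>") (auto simp: min_def)

lemma finite_scramble_values:
  assumes "finite (verts G)"
  shows "finite {h \<S> | \<S>. is_scramble G r \<S>}"
  by (rule finite_subset[of _ "h ` Pow (Pow (verts G))"]) (use assms in \<open>auto simp: is_scramble_def\<close>)

lemma bramble_is_scramble: "is_bramble G r \<B> \<Longrightarrow> is_scramble G r \<B>"
  using edge_connected_nonempty by (fastforce simp: is_bramble_def is_scramble_def)

lemma scramble_order_le_gonality:
  assumes G: "multigraph G" and r: "r \<ge> 1" and scr: "is_scramble G r \<S>"
  shows "int (scramble_order G r \<S>) \<le> gonality G r"
proof -
  obtain D where D: "int r \<le> rank G D" "deg G D = gonality G r"
    by (rule gonality_attained[OF G])
  obtain k where k: "equiv_effective G D" "subtractable G D k" "r \<le> k"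
    by (rule le_rankD[OF G D(1)])
  obtain f where f: "\<And>v. v \<in> verts G \<Longrightarrow> 0 \<le> D v - laplacian G f v"
    by (rule equiv_effectiveE[OF G k(1)]) blast
  define D0 where "D0 v = D v - laplacian G f v" for v
  have deg0: "deg G (\<lambda>v. D0 v - laplacian G g v) = gonality G r" for g
    unfolding deg_diff_laplacian using D(2) by (simp add: D0_def deg_diff_laplacian)
  show ?thesis
  \<comment> \<open>Either some effective divisor of the class hits all eggs and bounds the hitting
    number, or there is an egg-cut no larger than the degree.\<close>
  proof (cases "\<exists>g. (\<forall>v\<in>verts G. 0 \<le> D0 v - laplacian G g v) \<and>
      (\<forall>A\<in>\<S>. int r \<le> (\<Sum>v\<in>A. D0 v - laplacian G g v))")
    case True
    then obtain g where "\<And>v. v \<in> verts G \<Longrightarrow> 0 \<le> D0 v - laplacian G g v"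
      "\<And>A. A \<in> \<S> \<Longrightarrow> int r \<le> (\<Sum>v\<in>A. D0 v - laplacian G g v)" by blast
    then have "int (hitting_number G r \<S>) \<le> deg G (\<lambda>v. D0 v - laplacian G g v)"
      using G scr by (intro hitting_number_le_deg) (auto simp: multigraph_def is_scramble_def)
    moreover have "enat (scramble_order G r \<S>) \<le> enat (hitting_number G r \<S>)"
      unfolding enat_scramble_order by simp
    ultimately show ?thesis using deg0 by simp
  next
    case False
    have "\<exists>F. is_egg_cut G \<S> F \<and> int (card F) \<le> deg G D0"
    proof (rule scramble_egg_cut[OF G r scr])
      show "0 \<le> D0 v" if "v \<in> verts G" for v using f that by (simp add: D0_def)
      show "\<exists>h. (\<forall>w\<in>verts G. 0 \<le> D0 w - laplacian G h w) \<and> int r \<le> D0 v - laplacian G h v"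
        if v: "v \<in> verts G" for v
      proof -
        obtain g where g: "\<And>w. w \<in> verts G \<Longrightarrow> 0 \<le> D w - laplacian G g w"
          "int k \<le> D v - laplacian G g v" by (rule subtractable_point[OF G k(2) v]) blast
        have "D0 w - laplacian G (\<lambda>u. g u - f u) w = D w - laplacian G g w" for w
          by (simp add: D0_def laplacian_diff)
        then show ?thesis using g k(3) by (intro exI[of _ "\<lambda>u. g u - f u"]) auto
      qed
      show "\<exists>A\<in>\<S>. (\<Sum>v\<in>A. D0 v - laplacian G g v) < int r"
        if "\<forall>w\<in>verts G. 0 \<le> D0 w - laplacian G g w" for g
        using False that by (meson not_le)
    qed
    then obtain F where F: "is_egg_cut G \<S> F" "int (card F) \<le> deg G D0" by blast
    have "enat (scramble_order G r \<S>) \<le> egg_cut_number G \<S>"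
      unfolding enat_scramble_order by simp
    also have "\<dots> \<le> enat (card F)"
      unfolding egg_cut_number_def by (rule INF_lower) (use F in simp)
    finally show ?thesis using F(2) deg0[of "\<lambda>_. 0"] by simp
  qed
qed

text \<open>The order being a minimum, it is enough to compare with egg-cuts: a component
  \<open>X\<close> of one separates two members, and its boundary lies in the cut. Without egg-cuts
  the infimum is \<infinity>.\<close>

lemma hitting_number_le_scramble_order:
  assumes G: "multigraph G" and r: "r \<ge> 1" and br: "is_bramble G r \<B>"
  shows "hitting_number G r \<B> \<le> scramble_order G r \<B> + r"
proof -
  have fin: "finite (edges G)" using G by (simp add: multigraph_def)
  have "hitting_number G r \<B> - r \<le> card F" if cut: "is_egg_cut G \<B> F" for F
  proof -
    obtain X Y A B where X: "X \<in> mg_components (delete_edges G F)"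
      and Y: "Y \<in> mg_components (delete_edges G F)"
      and *: "X \<noteq> Y" "A \<in> \<B>" "A \<subseteq> X" "B \<in> \<B>" "B \<subseteq> Y" "F \<subseteq> edges G"
      using cut unfolding is_egg_cut_def by blast
    have "B \<inter> X = {}" using components_disjoint[OF X Y] * by blast
    moreover have "X \<subseteq> verts G" using X by (auto simp: mg_components_def delete_edges_def)
    ultimately have "hitting_number G r \<B> \<le> card (boundary G X) + r"
      using bramble_hitting_number_le[OF fin r br] * by blast
    also have "card (boundary G X) \<le> card F"
      using boundary_component[OF X] * fin by (meson card_mono finite_subset)
    finally show ?thesis by simp
  qed
  then have "enat (hitting_number G r \<B> - r) \<le> egg_cut_number G \<B>"
    unfolding egg_cut_number_def by (intro INF_greatest) simp
  then have "enat (hitting_number G r \<B> - r) \<le> enat (scramble_order G r \<B>)"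
    unfolding enat_scramble_order by simp
  then show ?thesis by simp
qed

theorem theorem5p4:
  fixes G :: "('v, 'e) mgraph" and r :: nat
  assumes "multigraph G" and "r \<ge> 1"
  shows "treewidth G r \<le> int (scramble_number G r) \<and> int (scramble_number G r) \<le> gonality G r"
proof
  have fin: "finite (verts G)" using assms(1) by (simp add: multigraph_def)
  let ?brambles = "{hitting_number G r \<B> | \<B>. is_bramble G r \<B>}"
  let ?orders = "{scramble_order G r \<S> | \<S>. is_scramble G r \<S>}"
  have "finite ?brambles"
    by (rule finite_subset[OF _ finite_scramble_values[OF fin, of "hitting_number G r" r]])
      (use bramble_is_scramble in blast)
  \<comment> \<open>The empty collection qualifies vacuously as bramble and as scramble, so both
    maxima are attained.\<close>
  moreover have "is_bramble G r {}" by (simp add: is_bramble_def)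
  then have "?brambles \<noteq> {}" by blast
  ultimately have "bramble_number G r \<in> ?brambles"
    unfolding bramble_number_def by (rule Max_in)
  moreover have "is_scramble G r {}" by (simp add: is_scramble_def)
  then have "?orders \<noteq> {}" by blast
  then have "scramble_number G r \<in> ?orders"
    unfolding scramble_number_def by (rule Max_in[OF finite_scramble_values[OF fin]])
  ultimately obtain \<B> \<S> where \<B>: "is_bramble G r \<B>" "bramble_number G r = hitting_number G r \<B>"
    and \<S>: "is_scramble G r \<S>" "scramble_number G r = scramble_order G r \<S>" by blast
  have "scramble_order G r \<B> \<le> scramble_number G r"
    unfolding scramble_number_def
    by (rule Max_ge[OF finite_scramble_values[OF fin]]) (use bramble_is_scramble[OF \<B>(1)] in blast)
  then show "treewidth G r \<le> int (scramble_number G r)"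
    using hitting_number_le_scramble_order[OF assms \<B>(1)] \<B>(2) by (simp add: treewidth_def)
  show "int (scramble_number G r) \<le> gonality G r"
    using scramble_order_le_gonality[OF assms \<S>(1)] \<S>(2) by simp
qed

end
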